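(* Let $\mathcal{X}$ and $\mathcal{Y}$ be measurable spaces, let $\mu$ be a probability measure on $\mathcal{X}$ and $\nu$ a probability measure on $\mathcal{Y}$, and let $p:\mathcal{X}\times\mathcal{Y}\to[0,\infty)$ be jointly measurable. Suppose that $p$ is positive, i.e. $p(x,y)>0$ for all $x\in\mathcal{X}$, $y\in\mathcal{Y}$, that $p$ is bounded, i.e. $\sup_{x\in\mathcal{X},y\in\mathcal{Y}}p(x,y)<\infty$, and that $$\int_{\mathcal{Y}}\Big[\int_{\mathcal{X}}p(x,y)\,\mu(dx)\Big]^{-1}\nu(dy)<\infty\quad\text{or}\quad\int_{\mathcal{X}}\Big[\int_{\mathcal{Y}}p(x,y)\,\nu(dy)\Big]^{-1}\mu(dx)<\infty.$$ Then the Schrödinger system $$\mathsf{a}(dx)\int_{\mathcal{Y}}p(x,y)\,\mathsf{b}(dy)=\mu(dx),\qquad \mathsf{b}(dy)\int_{\mathcal{X}}p(x,y)\,\mathsf{a}(dx)=\nu(dy)$$ admits a unique solution $(\mathsf{a},\mathsf{b})$, uniqueness being understood up to the transformations $(\mathsf{a},\mathsf{b})\mapsto(\kappa^{-1}\mathsf{a},\kappa\mathsf{b})$, $\kappa>0$.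
   Context: A solution of the Schrödinger system is a pair $(\mathsf{a},\mathsf{b})$ where $\mathsf{a}$ is a $\sigma$-finite nonnegative measure on $\mathcal{X}$ and $\mathsf{b}$ is a $\sigma$-finite nonnegative measure on $\mathcal{Y}$ satisfying the two displayed identities between measures (on $\mathcal{X}$ and on $\mathcal{Y}$ respectively). *)

theory Defs
  imports "HOL-Probability.Probability"
begin

text \<open>
  The measurable spaces are carried by \<open>\<mu>\<close> and \<open>\<nu>\<close>: a measure \<open>a\<close> on the first space is one
  with \<open>sets a = sets \<mu>\<close>.  The inner integrals take values in \<open>[0,\<infinity>]\<close>; no finiteness is built
  in, and \<open>density\<close> uses the convention \<open>\<infinity> * 0 = 0\<close>.
\<close>

definition schroedinger_solution ::
  "'a measure \<Rightarrow> 'b measure \<Rightarrow> ('a \<Rightarrow> 'b \<Rightarrow> real) \<Rightarrow> 'a measure \<Rightarrow> 'b measure \<Rightarrow> bool"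
where
  "schroedinger_solution \<mu> \<nu> p a b \<longleftrightarrow>
     sigma_finite_measure a \<and> sets a = sets \<mu> \<and>
     sigma_finite_measure b \<and> sets b = sets \<nu> \<and>
     density a (\<lambda>x. \<integral>\<^sup>+ y. ennreal (p x y) \<partial>b) = \<mu> \<and>
     density b (\<lambda>y. \<integral>\<^sup>+ x. ennreal (p x y) \<partial>a) = \<nu>"

end

theory Submission
  imports Defs
begin

text \<open>
  Write \<open>a = \<mu> / u\<close> and \<open>b = \<nu> / v\<close>.  The system says \<open>v(y) = \<integral> p(x,y) / u(x) \<mu>(dx)\<close> and \<open>u = T u\<close>, where
  \<open>(T u)(x) = \<integral> p(x,y) / v(y) \<nu>(dy)\<close> is monotone in \<open>u\<close>.  By Fubini, \<open>\<integral> (T u) / u d\<mu> = \<nu>(v < \<infinity>)\<close>, so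
  \<open>u \<le> T u\<close>, or \<open>T u \<le> u\<close> together with \<open>v < \<infinity>\<close>, already forces \<open>T u = u\<close> almost everywhere.
  Following Fortet, iterate \<open>w \<mapsto> max (1/(n+2)) (min 1 (T w))\<close> from \<open>w = 1\<close>; this decreases to some \<open>u\<close>.
  If the limiting \<open>v\<close> is infinite almost everywhere, then \<open>T w \<rightarrow> 0\<close> uniformly, by dominated convergence
  and the integrability hypothesis, so some iterate satisfies \<open>T w \<le> w\<close>.  Otherwise \<open>T u > 0\<close> and
  \<open>u = min 1 (T u) \<le> T u\<close>.

  For uniqueness, let \<open>p f g\<close> and \<open>p f' g'\<close> be the densities with respect to \<open>\<mu> \<otimes> \<nu>\<close> of the couplings
  given by two solutions.  Having equal marginals, they give the same integral to the bounded function
  \<open>f' / (f + f') + g' / (g + g') - 1\<close>.  The integrand of the difference of the two integrals is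
  \<open>p (f' g' - f g)\<^sup>2 / ((f + f') (g + g')) \<ge> 0\<close>, whence \<open>f' g' = f g\<close> almost everywhere.
\<close>

section \<open>Extended nonnegative reals, densities and the symmetry of the system\<close>

lemma nn_integral_eq_imp_AE_eq:
  fixes f g :: "'a \<Rightarrow> ennreal"
  assumes [measurable]: "f \<in> borel_measurable M" "g \<in> borel_measurable M"
    and le: "AE x in M. f x \<le> g x"
    and ge: "integral\<^sup>N M g \<le> integral\<^sup>N M f" and fin: "integral\<^sup>N M f < \<infinity>"
  shows "AE x in M. f x = g x"
proof -
  \<comment> \<open>Finiteness of the integral of \<open>f\<close> permits splitting the integral of
    the truncated difference; the reversed inequality then makes it vanish.\<close>
  have "(\<integral>\<^sup>+ x. g x - f x \<partial>M) = integral\<^sup>N M g - integral\<^sup>N M f"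
    using fin le by (intro nn_integral_diff) auto
  also have "\<dots> = 0"
    using ge fin by (intro diff_eq_0_ennreal) (auto simp: order_le_less_trans)
  finally have "AE x in M. g x - f x = 0"
    by (subst (asm) nn_integral_0_iff_AE) auto
  then show ?thesis
    using le by eventually_elim (auto simp: diff_eq_0_iff_ennreal intro: antisym)
qed

lemma density_mult_const:
  assumes [measurable]: "f \<in> borel_measurable M"
  shows "density M (\<lambda>x. c * f x) = scale_measure c (density M f)"
  by (rule measure_eqI) (auto simp: emeasure_density nn_integral_cmult mult.assoc)

lemma tendsto_inverse_ennreal:
  fixes f :: "nat \<Rightarrow> ennreal"
  assumes "f \<longlonglongrightarrow> l"
  shows "(\<lambda>n. inverse (f n)) \<longlonglongrightarrow> inverse l"
  using continuous_on_tendsto_compose[OF continuous_on_inverse_ennreal[OF continuous_on_id[of UNIV]] assms]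
  by simp

lemma ennreal_mult_inverse_self: "0 < x \<Longrightarrow> x < top \<Longrightarrow> x * inverse x = (1::ennreal)"
  by (metis divide_ennreal_def ennreal_divide_self less_irrefl)

lemma ennreal_inverse_antimono: "a \<le> b \<Longrightarrow> inverse b \<le> inverse (a::ennreal)"
  by (simp add: less_eq_ennreal.rep_eq inverse_ennreal.rep_eq ereal_inverse_antimono)

lemma density_cong_space:
  assumes "f \<in> borel_measurable M" and "\<And>x. x \<in> space M \<Longrightarrow> f x = g x"
  shows "density M f = density M g"
  using assms measurable_cong[of M f g borel] by (intro density_cong) (auto intro!: AE_I2)

lemma schroedinger_solution_swap:
  "schroedinger_solution M N p a b \<longleftrightarrow> schroedinger_solution N M (\<lambda>y x. p x y) b a"
  by (auto simp: schroedinger_solution_def)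

section \<open>Positive kernels and Fortet's map\<close>

locale schroedinger_kernel = M: prob_space M + N: prob_space N
  for M :: "'a measure" and N :: "'b measure" +
  fixes p :: "'a \<Rightarrow> 'b \<Rightarrow> real"
  assumes kernel_measurable [measurable]: "(\<lambda>(x, y). p x y) \<in> borel_measurable (M \<Otimes>\<^sub>M N)"
    and kernel_pos: "\<And>x y. x \<in> space M \<Longrightarrow> y \<in> space N \<Longrightarrow> p x y > 0"
begin

sublocale pair_prob_space M N ..

text \<open>The locale assumptions are symmetric in the two spaces. This instance carries facts
  about the first factor over to the second and exchanges the two alternatives of the integrability
  hypothesis.\<close>

lemma swapped: "schroedinger_kernel N M (\<lambda>y x. p x y)"
proof
  show "(\<lambda>(y, x). p x y) \<in> borel_measurable (N \<Otimes>\<^sub>M M)"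
    using measurable_pair_swap[OF kernel_measurable] by (simp add: case_prod_beta)
qed (use kernel_pos in auto)

text \<open>The function v of the outline for u = \<open>w\<close>. Values in \<open>ennreal\<close>
  allow \<open>w\<close> to vanish and the integral to diverge.\<close>

definition marginal :: "('a \<Rightarrow> ennreal) \<Rightarrow> 'b \<Rightarrow> ennreal" where
  "marginal w y = (\<integral>\<^sup>+ x. ennreal (p x y) * inverse (w x) \<partial>M)"

text \<open>The monotone map T of the outline. Points with infinite \<open>marginal w y\<close>
  contribute nothing, since \<open>inverse top = 0\<close>.\<close>

definition fortet :: "('a \<Rightarrow> ennreal) \<Rightarrow> 'a \<Rightarrow> ennreal" where
  "fortet w x = (\<integral>\<^sup>+ y. ennreal (p x y) * inverse (marginal w y) \<partial>N)"

lemma marginal_measurable [measurable]: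
  assumes [measurable]: "w \<in> borel_measurable M"
  shows "marginal w \<in> borel_measurable N"
  unfolding marginal_def by measurable

lemma fortet_measurable [measurable]:
  assumes [measurable]: "w \<in> borel_measurable M"
  shows "fortet w \<in> borel_measurable M"
  unfolding fortet_def by measurable

lemma marginal_antimono:
  assumes "\<And>x. w x \<le> w' x"
  shows "marginal w' y \<le> marginal w y"
  unfolding marginal_def
  by (intro nn_integral_mono mult_left_mono ennreal_inverse_antimono assms) auto

lemma fortet_mono:
  assumes "\<And>x. w x \<le> w' x"
  shows "fortet w x \<le> fortet w' x"
  unfolding fortet_def
  by (intro nn_integral_mono mult_left_mono ennreal_inverse_antimono marginal_antimono assms) auto

text \<open>As the kernel is positive, a zero integral would force \<open>w = top\<close> almost
  everywhere, which the bound by 1 excludes on a space of mass 1.\<close>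

lemma marginal_pos:
  assumes [measurable]: "w \<in> borel_measurable M" and "\<And>x. w x \<le> 1" and y: "y \<in> space N"
  shows "marginal w y > 0"
proof (rule ccontr)
  assume "\<not> marginal w y > 0"
  then have "AE x in M. ennreal (p x y) * inverse (w x) = 0"
    using y unfolding marginal_def by (subst (asm) not_gr_zero, subst (asm) nn_integral_0_iff_AE) auto
  then have "AE x in M. False"
    using AE_space
  proof eventually_elim
    case (elim x)
    then have "w x = top" using kernel_pos[OF elim(2) y] by auto
    then show False using assms(2)[of x] by (simp add: top_unique)
  qed
  then show False by simp
qed

text \<open>By Tonelli, both sides are the double integral of
  \<open>p x y / (w x * marginal w y)\<close>.\<close>

lemma nn_integral_fortet_ratio:
  assumes [measurable]: "w \<in> borel_measurable M"
  shows "(\<integral>\<^sup>+ x. fortet w x * inverse (w x) \<partial>M) = (\<integral>\<^sup>+ y. marginal w y * inverse (marginal w y) \<partial>N)"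
proof -
  have "(\<integral>\<^sup>+ x. fortet w x * inverse (w x) \<partial>M) =
      (\<integral>\<^sup>+ x. \<integral>\<^sup>+ y. ennreal (p x y) * inverse (marginal w y) * inverse (w x) \<partial>N \<partial>M)"
    unfolding fortet_def by (intro nn_integral_cong nn_integral_multc[symmetric]) measurable
  also have "\<dots> = (\<integral>\<^sup>+ y. \<integral>\<^sup>+ x. ennreal (p x y) * inverse (marginal w y) * inverse (w x) \<partial>M \<partial>N)"
    by (rule Fubini'[symmetric]) measurable
  also have "\<dots> = (\<integral>\<^sup>+ y. marginal w y * inverse (marginal w y) \<partial>N)"
    unfolding marginal_def[of w] 
    by (intro nn_integral_cong, subst nn_integral_multc[symmetric]) (auto simp: mult_ac)
  finally show ?thesis .
qed

text \<open>The integrand is an indicator: it is 1 where the marginal is finite, as the value 0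
  cannot occur, and \<open>top * inverse top = 0\<close> elsewhere.\<close>

lemma nn_integral_mult_inverse_marginal:
  assumes [measurable]: "w \<in> borel_measurable M" and "\<And>x. w x \<le> 1"
  shows "(\<integral>\<^sup>+ y. marginal w y * inverse (marginal w y) \<partial>N) =
    emeasure N {y \<in> space N. marginal w y < \<infinity>}"
proof -
  have "(\<integral>\<^sup>+ y. marginal w y * inverse (marginal w y) \<partial>N) =
      (\<integral>\<^sup>+ y. indicator {y \<in> space N. marginal w y < \<infinity>} y \<partial>N)"
    using marginal_pos[OF assms]
    by (intro nn_integral_cong) (auto simp: indicator_def less_top ennreal_mult_inverse_self)
  then show ?thesis by simp
qed

text \<open>The solution is \<open>M / w\<close> and \<open>N / marginal w\<close>. Integrating the
  kernel against them gives \<open>marginal w\<close> and \<open>fortet w\<close>, so the system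
  reduces to \<open>fortet w = w\<close> and to cancelling a finite, positive marginal. Positivity
  of \<open>w\<close> and of the marginal makes both densities finite, hence both measures
  sigma-finite.\<close>

lemma fixed_point_imp_solution:
  assumes [measurable]: "w \<in> borel_measurable M"
    and w: "\<And>x. w x \<le> 1" "\<And>x. x \<in> space M \<Longrightarrow> w x > 0"
    and fp: "AE x in M. fortet w x = w x"
    and fin: "AE y in N. marginal w y < \<infinity>"
  shows "\<exists>a b. schroedinger_solution M N p a b"
proof (intro exI)
  define a where "a = density M (\<lambda>x. inverse (w x))"
  define b where "b = density N (\<lambda>y. inverse (marginal w y))"
  have w_fin: "w x < top" for x using w(1)[of x] by (simp add: order_le_less_trans)
  have a_int: "(\<integral>\<^sup>+ x. ennreal (p x y) \<partial>a) = marginal w y" if "y \<in> space N" for y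
    using that unfolding a_def marginal_def by (subst nn_integral_density) (auto simp: mult.commute)
  have b_int: "(\<integral>\<^sup>+ y. ennreal (p x y) \<partial>b) = fortet w x" if "x \<in> space M" for x
    using that unfolding b_def fortet_def by (subst nn_integral_density) (auto simp: mult.commute)
  have "density a (\<lambda>x. \<integral>\<^sup>+ y. ennreal (p x y) \<partial>b) = density a (fortet w)"
    by (rule density_cong_space[symmetric]) (simp_all add: a_def b_int)
  also have "\<dots> = density M (\<lambda>x. inverse (w x) * fortet w x)"
    unfolding a_def by (rule density_density_eq) auto
  also have "\<dots> = density M (\<lambda>x. 1)"
    using fp AE_space
    by (intro density_cong, measurable, eventually_elim)
      (use w w_fin in \<open>auto simp: less_top ennreal_mult_inverse_self mult.commute[of "inverse _"]\<close>)
  finally have 1: "density a (\<lambda>x. \<integral>\<^sup>+ y. ennreal (p x y) \<partial>b) = M" by (simp add: density_1)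
  have "density b (\<lambda>y. \<integral>\<^sup>+ x. ennreal (p x y) \<partial>a) = density b (marginal w)"
    by (rule density_cong_space[symmetric]) (simp_all add: b_def a_int)
  also have "\<dots> = density N (\<lambda>y. inverse (marginal w y) * marginal w y)"
    unfolding b_def by (rule density_density_eq) auto
  also have "\<dots> = density N (\<lambda>y. 1)"
    using fin AE_space
    by (intro density_cong, measurable, eventually_elim)
      (use marginal_pos[of w] w in \<open>auto simp: less_top ennreal_mult_inverse_self mult.commute[of "inverse _"]\<close>)
  finally have 2: "density b (\<lambda>y. \<integral>\<^sup>+ x. ennreal (p x y) \<partial>a) = N" by (simp add: density_1)
  have "sigma_finite_measure a"
    unfolding a_def using w(2) by (subst M.sigma_finite_iff_density_finite) (force intro!: AE_I2)+
  moreover have "sigma_finite_measure b"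
    unfolding b_def using marginal_pos[of w] w(1)
    by (subst N.sigma_finite_iff_density_finite) (force intro!: AE_I2)+
  ultimately show "schroedinger_solution M N p a b"
    unfolding schroedinger_solution_def using 1 2 by (simp add: a_def b_def)
qed

section \<open>Existence by monotone iteration\<close>

lemma exists_solution:
  assumes bound: "\<And>x y. x \<in> space M \<Longrightarrow> y \<in> space N \<Longrightarrow> p x y \<le> C"
    and fin: "(\<integral>\<^sup>+ y. inverse (\<integral>\<^sup>+ x. ennreal (p x y) \<partial>M) \<partial>N) < \<infinity>"
  shows "\<exists>a b. schroedinger_solution M N p a b"
proof -
  \<comment> \<open>The cap at 1 makes the first step decrease. The floor keeps
    \<open>inverse (w n)\<close> bounded for each \<open>n\<close> and disappears in the limit; with
    \<open>n + 2\<close> in the successor step, \<open>w n\<close> is at least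
    \<open>1 / (n + 1)\<close> for every \<open>n\<close>, including \<open>n = 0\<close>.\<close>
  define w :: "nat \<Rightarrow> 'a \<Rightarrow> ennreal"
    where "w = rec_nat (\<lambda>_. 1) (\<lambda>n f x. max (inverse (of_nat (n + 2))) (min 1 (fortet f x)))"
  have w_0': "w 0 = (\<lambda>_. 1)" by (simp add: w_def)
  have w_0: "w 0 x = 1" for x by (simp add: w_0')
  have w_Suc: "w (Suc n) x = max (inverse (of_nat (n + 2))) (min 1 (fortet (w n) x))" for n x
    by (simp add: w_def)
  have w_Suc': "w (Suc n) = (\<lambda>x. max (inverse (of_nat (n + 2))) (min 1 (fortet (w n) x)))" for n
    using w_Suc by auto
  have w_meas [measurable]: "w n \<in> borel_measurable M" for n
    by (induction n) (simp_all add: w_0' w_Suc')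
  have inv_le: "inverse (of_nat (Suc n) :: ennreal) \<le> 1" for n
    using ennreal_inverse_antimono[of 1 "of_nat (Suc n)"] by simp
  have w_le: "w n x \<le> 1" for n x
    using inv_le[of "Suc _"] by (cases n) (auto simp: w_0 w_Suc)
  have w_ge: "inverse (of_nat (Suc n)) \<le> w n x" for n x
    by (cases n) (auto simp: w_0 w_Suc)
  have w_Suc_le: "w (Suc n) x \<le> w n x" for n x
  proof (induction n arbitrary: x)
    case 0 show ?case using w_le[of 1] by (simp add: w_0)
  next
    case (Suc n)
    have "inverse (of_nat (Suc n + 2) :: ennreal) \<le> inverse (of_nat (n + 2))"
      by (intro ennreal_inverse_antimono) auto
    moreover have "fortet (w (Suc n)) x \<le> fortet (w n) x"
      by (intro fortet_mono Suc)
    ultimately show ?case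
      unfolding w_Suc[of "Suc n"] w_Suc[of n] by (intro max.mono min.mono) auto
  qed
  define u where "u x = (INF n. w n x)" for x
  have u_meas [measurable]: "u \<in> borel_measurable M" unfolding u_def[abs_def] by measurable
  have u_le: "u x \<le> w n x" for x n unfolding u_def by (rule INF_lower) auto
  have u_le1: "u x \<le> 1" for x using u_le[of x 0] by (simp add: w_0)
  have w_lim: "(\<lambda>n. w n x) \<longlonglongrightarrow> u x" for x
    unfolding u_def by (intro LIMSEQ_INF decseq_SucI w_Suc_le)
  \<comment> \<open>Monotone convergence applies because \<open>inverse (w n)\<close> increases with
    \<open>n\<close>.\<close>
  have marginal_lim: "(\<lambda>n. marginal (w n) y) \<longlonglongrightarrow> marginal u y" if "y \<in> space N" for y
    unfolding marginal_def
  proof (rule nn_integral_LIMSEQ)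
    show "incseq (\<lambda>n x. ennreal (p x y) * inverse (w n x))"
      by (intro incseq_SucI le_funI mult_left_mono ennreal_inverse_antimono w_Suc_le) auto
    show "(\<lambda>n. ennreal (p x y) * inverse (w n x)) \<longlonglongrightarrow> ennreal (p x y) * inverse (u x)" for x
      by (intro ennreal_tendsto_cmult tendsto_inverse_ennreal w_lim) auto
  qed (use that in measurable)
  have inv_lim: "(\<lambda>n. inverse (marginal (w n) y)) \<longlonglongrightarrow> inverse (marginal u y)" if "y \<in> space N" for y
    by (intro tendsto_inverse_ennreal marginal_lim that)
  \<comment> \<open>Since \<open>w 0 = 1\<close>, the integrability hypothesis says that
    \<open>inverse (marginal (w 0))\<close> has finite integral. By antitonicity this one function
    dominates \<open>inverse (marginal (w n))\<close> for all \<open>n\<close>.\<close>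
  have marginal_0: "marginal (w 0) y = (\<integral>\<^sup>+ x. ennreal (p x y) \<partial>M)" for y
    by (simp add: marginal_def w_0)
  have w_le_0: "w n x \<le> w 0 x" for n x using w_le by (simp add: w_0)
  have inv_bound: "inverse (marginal (w n) y) \<le> inverse (marginal (w 0) y)" for n y
    by (intro ennreal_inverse_antimono marginal_antimono w_le_0)
  have fin0: "(\<integral>\<^sup>+ y. inverse (marginal (w 0) y) \<partial>N) < \<infinity>"
    using fin by (simp add: marginal_0)
  have p_le: "ennreal (p x y) \<le> ennreal C" if "x \<in> space M" "y \<in> space N" for x y
    using bound[OF that] by (rule ennreal_leI)
  \<comment> \<open>The right-hand side does not depend on \<open>x\<close>, so the smallness
    obtained from it below is uniform.\<close>
  have fortet_le: "fortet v x \<le> ennreal C * (\<integral>\<^sup>+ y. inverse (marginal v y) \<partial>N)"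
    if [measurable]: "v \<in> borel_measurable M" and "x \<in> space M" for v x
    unfolding fortet_def using that p_le
    by (subst nn_integral_cmult[symmetric]) (auto intro!: nn_integral_mono mult_right_mono)
  show ?thesis
  proof (cases "AE y in N. marginal u y = \<infinity>")
    case True
    have "(\<lambda>n. \<integral>\<^sup>+ y. inverse (marginal (w n) y) \<partial>N) \<longlonglongrightarrow> (\<integral>\<^sup>+ y. inverse (marginal u y) \<partial>N)"
      by (rule nn_integral_dominated_convergence[OF _ _ _ _ fin0])
        (auto intro!: AE_I2 inv_bound inv_lim)
    also have "(\<integral>\<^sup>+ y. inverse (marginal u y) \<partial>N) = (\<integral>\<^sup>+ y. 0 \<partial>N)"
      using True by (intro nn_integral_cong_AE) auto
    finally have "(\<lambda>n. ennreal C * (\<integral>\<^sup>+ y. inverse (marginal (w n) y) \<partial>N)) \<longlonglongrightarrow> ennreal C * 0"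
      by (intro ennreal_tendsto_cmult) auto
    then have "eventually (\<lambda>n. ennreal C * (\<integral>\<^sup>+ y. inverse (marginal (w n) y) \<partial>N) < 1) sequentially"
      by (rule order_tendstoD) auto
    then obtain n where n: "ennreal C * (\<integral>\<^sup>+ y. inverse (marginal (w n) y) \<partial>N) < 1"
      by (auto simp: eventually_sequentially)
    \<comment> \<open>Below 1 the cap is inactive and the floor only increases the value, so
      \<open>fortet (w n)\<close> lies below \<open>w (Suc n)\<close>, hence below
      \<open>w n\<close>.\<close>
    have le: "fortet (w n) x \<le> w n x" if "x \<in> space M" for x
    proof -
      have "fortet (w n) x \<le> 1"
        using fortet_le[OF w_meas[of n] that] n by (meson less_imp_le order_trans)
      then have "fortet (w n) x \<le> w (Suc n) x" by (simp add: w_Suc)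
      then show ?thesis using w_Suc_le by (rule order_trans)
    qed
    have w_pos: "w n x > 0" for x
      using w_ge[of n x] by (rule less_le_trans[rotated]) (simp add: ennreal_inverse_positive)
    have w_top: "w n x < top" for x using w_le[of n x] by (simp add: order_le_less_trans)
    \<comment> \<open>The floor gives \<open>inverse (w n x) \<le> n + 1\<close>, and the kernel is
      bounded by \<open>C\<close>.\<close>
    have marg_fin: "marginal (w n) y < \<infinity>" if "y \<in> space N" for y
    proof -
      have "marginal (w n) y \<le> (\<integral>\<^sup>+ x. ennreal C * of_nat (Suc n) \<partial>M)"
        unfolding marginal_def
      proof (intro nn_integral_mono mult_mono p_le that)
        show "inverse (w n x) \<le> of_nat (Suc n)" for x
          using ennreal_inverse_antimono[OF w_ge[of n x]] one_divide_one_divide_ennreal[of "of_nat (Suc n)"]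
            by (simp add: divide_ennreal_def del: of_nat_Suc one_divide_one_divide_ennreal)
      qed auto
      also have "\<dots> < \<infinity>" by (simp add: M.emeasure_space_1 ennreal_mult_less_top of_nat_less_top del: of_nat_Suc)
      finally show ?thesis .
    qed
    have "(\<integral>\<^sup>+ x. fortet (w n) x * inverse (w n x) \<partial>M) = emeasure N (space N)"
      using nn_integral_fortet_ratio[of "w n"] nn_integral_mult_inverse_marginal[of "w n"] w_le marg_fin
      by (auto intro!: arg_cong[where f = "emeasure N"])
    then have eq: "(\<integral>\<^sup>+ x. fortet (w n) x * inverse (w n x) \<partial>M) = 1" by (simp add: N.emeasure_space_1)
    \<comment> \<open>The ratio is at most 1 pointwise and has integral 1.\<close>
    have "AE x in M. fortet (w n) x * inverse (w n x) = 1"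
    proof (rule nn_integral_eq_imp_AE_eq)
      show "AE x in M. fortet (w n) x * inverse (w n x) \<le> 1"
        using AE_space by eventually_elim
          (metis ennreal_mult_inverse_self le mult_right_mono w_pos w_top zero_le)
    qed (auto simp: eq M.emeasure_space_1)
    then have "AE x in M. fortet (w n) x = w n x"
      by eventually_elim (metis ennreal_mult_inverse_self mult.assoc mult.commute mult.right_neutral w_pos w_top)
    then show ?thesis
      using w_le w_pos marg_fin by (intro fixed_point_imp_solution[of "w n"]) (auto intro!: AE_I2)
  next
    case False
    \<comment> \<open>The recursion passes to the limit: \<open>fortet (w n) x\<close> converges by
      dominated convergence, and the floor tends to 0.\<close>
    have u_eq: "u x = min 1 (fortet u x)" if x: "x \<in> space M" for x
    proof -
      have fortet_lim: "(\<lambda>n. fortet (w n) x) \<longlonglongrightarrow> fortet u x"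
        unfolding fortet_def
      proof (rule nn_integral_dominated_convergence)
        show "(\<integral>\<^sup>+ y. ennreal C * inverse (marginal (w 0) y) \<partial>N) < \<infinity>"
          using fin0 by (subst nn_integral_cmult) (auto simp: ennreal_mult_less_top)
        show "AE y in N. ennreal (p x y) * inverse (marginal (w n) y) \<le> ennreal C * inverse (marginal (w 0) y)" for n
          using x by (intro AE_I2 mult_mono p_le inv_bound) auto
        show "AE y in N. (\<lambda>n. ennreal (p x y) * inverse (marginal (w n) y)) \<longlonglongrightarrow> ennreal (p x y) * inverse (marginal u y)"
          by (intro AE_I2 ennreal_tendsto_cmult inv_lim) auto
      qed (use x in measurable)
      have "(\<lambda>n. inverse (of_nat (n + 2) :: ennreal)) \<longlonglongrightarrow> 0"
        using tendsto_inverse_ennreal[OF LIMSEQ_ignore_initial_segment[OF of_nat_tendsto_top_ennreal, of 2]] by simp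
      then have "(\<lambda>n. w (Suc n) x) \<longlonglongrightarrow> max 0 (min 1 (fortet u x))"
        unfolding w_Suc by (intro tendsto_max tendsto_min fortet_lim tendsto_const)
      then show ?thesis
        using LIMSEQ_Suc[OF w_lim[of x]] LIMSEQ_unique by fastforce
    qed
    \<comment> \<open>A zero of \<open>fortet u\<close> would make \<open>marginal u\<close>
      infinite almost everywhere, which is excluded in this case.\<close>
    have fortet_pos: "fortet u x > 0" if x: "x \<in> space M" for x
    proof (rule ccontr)
      assume "\<not> fortet u x > 0"
      then have "AE y in N. ennreal (p x y) * inverse (marginal u y) = 0"
        using x unfolding fortet_def by (subst (asm) not_gr_zero, subst (asm) nn_integral_0_iff_AE) auto
      then have "AE y in N. marginal u y = \<infinity>"
        using AE_space by eventually_elim (use kernel_pos[OF x] in \<open>auto simp: ennreal_eq_0_iff not_le[symmetric]\<close>)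
      then show False using False by simp
    qed
    have u_pos: "u x > 0" if "x \<in> space M" for x using u_eq[OF that] fortet_pos[OF that] by simp
    have u_top: "u x < top" for x using u_le1[of x] by (simp add: order_le_less_trans)
    have int_eq: "(\<integral>\<^sup>+ x. fortet u x * inverse (u x) \<partial>M) = emeasure N {y \<in> space N. marginal u y < \<infinity>}"
      using nn_integral_fortet_ratio[of u] nn_integral_mult_inverse_marginal[of u] u_le1 by simp
    \<comment> \<open>Here the ratio is at least 1, because \<open>u = min 1 (fortet u)\<close>,
      while its integral is the \<open>N\<close>-measure of a set and so at most 1.\<close>
    have ratio: "AE x in M. 1 = fortet u x * inverse (u x)"
    proof (rule nn_integral_eq_imp_AE_eq)
      show "AE x in M. 1 \<le> fortet u x * inverse (u x)"
      proof (rule AE_I2)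
        fix x assume x: "x \<in> space M"
        have "u x * inverse (u x) \<le> fortet u x * inverse (u x)"
          using u_eq[OF x] by (intro mult_right_mono) auto
        then show "1 \<le> fortet u x * inverse (u x)"
          using ennreal_mult_inverse_self[OF u_pos[OF x] u_top] by simp
      qed
    qed (auto simp: int_eq M.emeasure_space_1 N.emeasure_le_1)
    have "AE x in M. fortet u x = u x"
      using ratio AE_space
      by eventually_elim (metis ennreal_mult_inverse_self mult.assoc mult.commute mult.right_neutral u_pos u_top)
    \<comment> \<open>The ratio now has integral exactly 1, so the set where the marginal is finite
      has full measure.\<close>
    moreover have "AE y in N. marginal u y < \<infinity>"
    proof -
      have "(\<integral>\<^sup>+ x. fortet u x * inverse (u x) \<partial>M) = (\<integral>\<^sup>+ x. 1 \<partial>M)"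
        using ratio by (intro nn_integral_cong_AE) auto
      then have "emeasure N {y \<in> space N. marginal u y < \<infinity>} = 1"
        by (simp add: int_eq M.emeasure_space_1)
      then show ?thesis
        by (intro N.AE_I_eq_1) auto
    qed
    ultimately show ?thesis
      using u_le1 u_pos by (intro fixed_point_imp_solution[of u]) auto
  qed
qed

section \<open>Positive densities of an arbitrary solution\<close>

lemma solution_density:
  assumes "schroedinger_solution M N p a b"
  obtains f :: "'a \<Rightarrow> real" where "f \<in> borel_measurable M" "\<And>x. f x > 0"
    "a = density M (\<lambda>x. ennreal (f x))"
    "AE x in M. ennreal (f x) * (\<integral>\<^sup>+ y. ennreal (p x y) \<partial>b) = 1"
proof -
  have sets [measurable_cong]: "sets a = sets M" "sets b = sets N"
    and "sigma_finite_measure b" and dens: "density a (\<lambda>x. \<integral>\<^sup>+ y. ennreal (p x y) \<partial>b) = M"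
    using assms by (auto simp: schroedinger_solution_def)
  interpret b: sigma_finite_measure b by fact
  have spaces: "space a = space M" "space b = space N"
    using sets by (auto dest: sets_eq_imp_space_eq)
  define U where "U x = (\<integral>\<^sup>+ y. ennreal (p x y) \<partial>b)" for x
  have U_meas_a: "U \<in> borel_measurable a" unfolding U_def[abs_def] by measurable
  then have [measurable]: "U \<in> borel_measurable M" by (simp add: measurable_cong_sets[OF sets(1) refl])
  note U_meas_a [measurable]
  have M_eq: "density a U = M" using dens by (simp add: U_def[abs_def])
  have U_int: "(\<integral>\<^sup>+ x. U x \<partial>a) = 1"
  proof -
    have "(\<integral>\<^sup>+ x. U x \<partial>a) = emeasure (density a U) (space a)"
      by (subst emeasure_density) (auto intro!: nn_integral_cong)
    then show ?thesis by (simp add: M_eq spaces M.emeasure_space_1)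
  qed
  \<comment> \<open>A single zero of \<open>U\<close> forces \<open>b\<close> to be the null
    measure, as the kernel is positive. Then \<open>U\<close> vanishes everywhere, against its
    integral 1.\<close>
  have U_pos: "U x > 0" if x: "x \<in> space M" for x
  proof (rule ccontr)
    assume "\<not> U x > 0"
    then have "AE y in b. ennreal (p x y) = 0"
      using x unfolding U_def by (subst (asm) not_gr_zero, subst (asm) nn_integral_0_iff_AE) auto
    then have "AE y in b. False"
      using AE_space by eventually_elim (use kernel_pos[OF x] in \<open>auto simp: spaces not_le[symmetric] ennreal_eq_0_iff\<close>)
    then have "AE y in b. ennreal (p x' y) = 0" for x'
      by eventually_elim simp
    from nn_integral_cong_AE[OF this] have "U x' = 0" for x'
      by (simp add: U_def)
    then show False using U_int by simp
  qed
  \<comment> \<open>Finiteness of \<open>U\<close> is obtained almost everywhere for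
    \<open>a\<close> and then transferred to \<open>M\<close>, the measure with density
    \<open>U\<close> relative to \<open>a\<close>.\<close>
  from U_int have U_fin_a: "AE x in a. U x \<noteq> \<infinity>" by (intro nn_integral_PInf_AE) auto
  then have "AE x in density a U. U x \<noteq> \<infinity>" by (auto simp: AE_density)
  then have U_fin: "AE x in M. U x \<noteq> \<infinity>" by (simp only: M_eq)
  \<comment> \<open>The default 1 keeps \<open>f\<close> positive everywhere; it is used only on an
    \<open>M\<close>-null set.\<close>
  define f where "f x = (if 0 < U x \<and> U x < \<infinity> then enn2real (inverse (U x)) else 1)" for x
  have [measurable]: "f \<in> borel_measurable M" unfolding f_def[abs_def] by measurable
  have f_eq: "ennreal (f x) = inverse (U x)" if "0 < U x" "U x < \<infinity>" for x
    using that by (simp add: f_def less_top[symmetric])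
  have f_pos: "f x > 0" for x
    by (auto simp: f_def enn2real_positive_iff ennreal_inverse_positive less_top[symmetric])
  \<comment> \<open>Insert \<open>U * inverse U = 1\<close> and absorb \<open>U\<close> into
    \<open>a\<close>, which turns \<open>a\<close> into \<open>M\<close>.\<close>
  have "a = density a (\<lambda>x. 1)" by (simp add: density_1)
  also have "\<dots> = density a (\<lambda>x. U x * inverse (U x))"
    using U_fin_a AE_space by (intro density_cong, measurable, eventually_elim)
      (auto simp: spaces U_pos ennreal_mult_inverse_self less_top)
  also have "\<dots> = density (density a U) (\<lambda>x. inverse (U x))"
    by (rule density_density_eq[symmetric]) auto
  also have "\<dots> = density M (\<lambda>x. ennreal (f x))"
    unfolding M_eq using U_fin AE_space by (intro density_cong, measurable, eventually_elim)
      (auto simp: U_pos f_eq less_top)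
  finally have "a = density M (\<lambda>x. ennreal (f x))" .
  moreover have "AE x in M. ennreal (f x) * U x = 1"
    using U_fin AE_space by eventually_elim
      (auto simp: U_pos f_eq less_top ennreal_mult_inverse_self mult.commute[of "inverse _"])
  ultimately show ?thesis using f_pos by (intro that) (auto simp: U_def)
qed

section \<open>Couplings with equal marginals and product-form densities\<close>

lemma nn_integral_fst_marginal:
  fixes d :: "'a \<Rightarrow> 'b \<Rightarrow> ennreal"
  assumes [measurable]: "(\<lambda>(x, y). d x y) \<in> borel_measurable (M \<Otimes>\<^sub>M N)" "c \<in> borel_measurable M"
    and "AE x in M. (\<integral>\<^sup>+ y. d x y \<partial>N) = 1"
  shows "(\<integral>\<^sup>+ z. d (fst z) (snd z) * c (fst z) \<partial>(M \<Otimes>\<^sub>M N)) = (\<integral>\<^sup>+ x. c x \<partial>M)"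
proof -
  have "(\<integral>\<^sup>+ z. d (fst z) (snd z) * c (fst z) \<partial>(M \<Otimes>\<^sub>M N)) = (\<integral>\<^sup>+ x. \<integral>\<^sup>+ y. d x y * c x \<partial>N \<partial>M)"
    by (subst N.nn_integral_fst[symmetric]) auto
  also have "\<dots> = (\<integral>\<^sup>+ x. (\<integral>\<^sup>+ y. d x y \<partial>N) * c x \<partial>M)"
    by (intro nn_integral_cong nn_integral_multc) measurable
  also have "\<dots> = (\<integral>\<^sup>+ x. c x \<partial>M)"
    using assms(3) by (intro nn_integral_cong_AE) auto
  finally show ?thesis .
qed

lemma nn_integral_snd_marginal:
  fixes d :: "'a \<Rightarrow> 'b \<Rightarrow> ennreal"
  assumes [measurable]: "(\<lambda>(x, y). d x y) \<in> borel_measurable (M \<Otimes>\<^sub>M N)" "c \<in> borel_measurable N"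
    and "AE y in N. (\<integral>\<^sup>+ x. d x y \<partial>M) = 1"
  shows "(\<integral>\<^sup>+ z. d (fst z) (snd z) * c (snd z) \<partial>(M \<Otimes>\<^sub>M N)) = (\<integral>\<^sup>+ y. c y \<partial>N)"
proof -
  have "(\<integral>\<^sup>+ z. d (fst z) (snd z) * c (snd z) \<partial>(M \<Otimes>\<^sub>M N)) = (\<integral>\<^sup>+ y. \<integral>\<^sup>+ x. d x y * c y \<partial>M \<partial>N)"
    by (subst nn_integral_snd[symmetric]) auto
  also have "\<dots> = (\<integral>\<^sup>+ y. (\<integral>\<^sup>+ x. d x y \<partial>M) * c y \<partial>N)"
    by (intro nn_integral_cong nn_integral_multc) measurable
  also have "\<dots> = (\<integral>\<^sup>+ y. c y \<partial>N)"
    using assms(3) by (intro nn_integral_cong_AE) auto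
  finally show ?thesis .
qed

text \<open>Equal marginals make the integral of \<open>h\<close> vanish, so
  \<open>f' x * g' y = f x * g y\<close> for almost all pairs. Separating the variables then leaves
  one constant \<open>k\<close>.\<close>

lemma product_couplings_eq:
  fixes f f' :: "'a \<Rightarrow> real" and g g' :: "'b \<Rightarrow> real"
  assumes [measurable]: "f \<in> borel_measurable M" "f' \<in> borel_measurable M"
      "g \<in> borel_measurable N" "g' \<in> borel_measurable N"
    and pos: "\<And>x. f x > 0" "\<And>x. f' x > 0" "\<And>y. g y > 0" "\<And>y. g' y > 0"
    and marg: "AE x in M. (\<integral>\<^sup>+ y. ennreal (p x y * (f x * g y)) \<partial>N) = 1"
      "AE y in N. (\<integral>\<^sup>+ x. ennreal (p x y * (f x * g y)) \<partial>M) = 1"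
    and marg': "AE x in M. (\<integral>\<^sup>+ y. ennreal (p x y * (f' x * g' y)) \<partial>N) = 1"
      "AE y in N. (\<integral>\<^sup>+ x. ennreal (p x y * (f' x * g' y)) \<partial>M) = 1"
  obtains k where "k > 0" "AE x in M. f' x = inverse k * f x" "AE y in N. g' y = k * g y"
proof -
  define d where "d x y = p x y * (f x * g y)" for x y
  define d' where "d' x y = p x y * (f' x * g' y)" for x y
  define A where "A x = f' x / (f x + f' x)" for x
  define B where "B y = g' y / (g y + g' y)" for y
  define h where "h x y = p x y * (f' x * g' y - f x * g y)\<^sup>2 / ((f x + f' x) * (g y + g' y))" for x y
  have [measurable]: "A \<in> borel_measurable M" "B \<in> borel_measurable N"
    unfolding A_def[abs_def] B_def[abs_def] by measurable
  have p_meas [measurable]: "(\<lambda>z. p (fst z) (snd z)) \<in> borel_measurable (M \<Otimes>\<^sub>M N)"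
    using kernel_measurable by (simp add: case_prod_beta')
  have [measurable]: "(\<lambda>(x, y). d x y) \<in> borel_measurable (M \<Otimes>\<^sub>M N)"
    "(\<lambda>(x, y). d' x y) \<in> borel_measurable (M \<Otimes>\<^sub>M N)"
    "(\<lambda>(x, y). h x y) \<in> borel_measurable (M \<Otimes>\<^sub>M N)"
    unfolding d_def d'_def h_def case_prod_beta' by measurable
  note this[unfolded case_prod_beta', measurable]
  let ?P = "M \<Otimes>\<^sub>M N"
  have AB: "0 \<le> A x" "A x \<le> 1" "0 \<le> B y" "B y \<le> 1" for x y
    using pos(1,2)[of x] pos(3,4)[of y] by (auto simp: A_def B_def)
  \<comment> \<open>This is \<open>(d' - d) * (A + B - 1) = h\<close> with all negative terms moved
    across, so that it can be integrated in \<open>ennreal\<close> without subtraction.\<close>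
  have eq: "ennreal (h x y) + ennreal (d' x y) + (ennreal (d x y) * ennreal (A x) + ennreal (d x y) * ennreal (B y)) =
    ennreal (d' x y) * ennreal (A x) + ennreal (d' x y) * ennreal (B y) + ennreal (d x y)"
    if "x \<in> space M" "y \<in> space N" for x y
  proof -
    have nn: "0 \<le> d x y" "0 \<le> d' x y" "0 \<le> h x y"
      using kernel_pos[OF that] pos(1,2)[of x] pos(3,4)[of y] by (auto simp: d_def d'_def h_def)
    have ne: "f x + f' x \<noteq> 0" "g y + g' y \<noteq> 0"
      using pos(1,2)[of x] pos(3,4)[of y] by auto
    have "A x + B y - 1 = (f' x * g' y - f x * g y) / ((f x + f' x) * (g y + g' y))"
    proof -
      have "A x * (f x + f' x) = f' x" "B y * (g y + g' y) = g' y"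
        using ne by (simp_all add: A_def B_def)
      moreover have "(A x + B y - 1) * ((f x + f' x) * (g y + g' y)) = (A x * (f x + f' x)) * (g y + g' y)
          + (B y * (g y + g' y)) * (f x + f' x) - (f x + f' x) * (g y + g' y)"
        by (simp add: algebra_simps)
      ultimately have "(A x + B y - 1) * ((f x + f' x) * (g y + g' y)) = f' x * g' y - f x * g y"
        by (simp add: algebra_simps)
      then show ?thesis using ne by (simp add: eq_divide_eq)
    qed
    then have "(d' x y - d x y) * (A x + B y - 1) = h x y"
      by (simp add: d_def d'_def h_def power2_eq_square algebra_simps)
    then have "h x y + d' x y + (d x y * A x + d x y * B y) = d' x y * A x + d' x y * B y + d x y"
      by (simp add: algebra_simps)
    then show ?thesis
      using nn AB(1,2)[of x] AB(3,4)[of y] by (simp flip: ennreal_plus ennreal_mult add: add_nonneg_nonneg)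
  qed
  have dA: "(\<integral>\<^sup>+ z. ennreal (d (fst z) (snd z)) * ennreal (A (fst z)) \<partial>?P) = (\<integral>\<^sup>+ x. ennreal (A x) \<partial>M)"
    and d'A: "(\<integral>\<^sup>+ z. ennreal (d' (fst z) (snd z)) * ennreal (A (fst z)) \<partial>?P) = (\<integral>\<^sup>+ x. ennreal (A x) \<partial>M)"
    using marg marg' by (auto intro!: nn_integral_fst_marginal simp: d_def d'_def)
  have dB: "(\<integral>\<^sup>+ z. ennreal (d (fst z) (snd z)) * ennreal (B (snd z)) \<partial>?P) = (\<integral>\<^sup>+ y. ennreal (B y) \<partial>N)"
    and d'B: "(\<integral>\<^sup>+ z. ennreal (d' (fst z) (snd z)) * ennreal (B (snd z)) \<partial>?P) = (\<integral>\<^sup>+ y. ennreal (B y) \<partial>N)"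
    using marg marg' by (auto intro!: nn_integral_snd_marginal simp: d_def d'_def)
  have d1: "(\<integral>\<^sup>+ z. ennreal (d (fst z) (snd z)) \<partial>?P) = 1"
    and d'1: "(\<integral>\<^sup>+ z. ennreal (d' (fst z) (snd z)) \<partial>?P) = 1"
    using nn_integral_fst_marginal[of "\<lambda>x y. ennreal (d x y)" "\<lambda>_. 1"]
      nn_integral_fst_marginal[of "\<lambda>x y. ennreal (d' x y)" "\<lambda>_. 1"] marg marg'
    by (simp_all add: d_def[symmetric] d'_def[symmetric] M.emeasure_space_1)
  \<comment> \<open>Both numbers are at most 1, since \<open>A\<close> and \<open>B\<close> are;
    being finite, they can be cancelled from the integrated identity.\<close>
  define \<alpha> \<beta> where "\<alpha> = (\<integral>\<^sup>+ x. ennreal (A x) \<partial>M)" and "\<beta> = (\<integral>\<^sup>+ y. ennreal (B y) \<partial>N)"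
  have "\<alpha> \<le> (\<integral>\<^sup>+ x. 1 \<partial>M)" "\<beta> \<le> (\<integral>\<^sup>+ y. 1 \<partial>N)"
    unfolding \<alpha>_def \<beta>_def using AB(2,4) by (intro nn_integral_mono; simp)+
  then have \<alpha>\<beta>: "1 + (\<alpha> + \<beta>) < top"
    by (auto simp: M.emeasure_space_1 N.emeasure_space_1 order_le_less_trans)
  have "(\<integral>\<^sup>+ z. (ennreal (h (fst z) (snd z)) + ennreal (d' (fst z) (snd z))
        + (ennreal (d (fst z) (snd z)) * ennreal (A (fst z)) + ennreal (d (fst z) (snd z)) * ennreal (B (snd z)))) \<partial>?P) =
      (\<integral>\<^sup>+ z. (ennreal (d' (fst z) (snd z)) * ennreal (A (fst z))
        + ennreal (d' (fst z) (snd z)) * ennreal (B (snd z)) + ennreal (d (fst z) (snd z))) \<partial>?P)"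
    by (intro nn_integral_cong eq) (auto simp: space_pair_measure)
  then have "(\<integral>\<^sup>+ z. ennreal (h (fst z) (snd z)) \<partial>?P) + 1 + (\<alpha> + \<beta>) = \<alpha> + \<beta> + 1"
    by (simp add: nn_integral_add dA d'A dB d'B d1 d'1 \<alpha>_def \<beta>_def)
  then have "(1 + (\<alpha> + \<beta>)) + (\<integral>\<^sup>+ z. ennreal (h (fst z) (snd z)) \<partial>?P) = (1 + (\<alpha> + \<beta>)) + 0"
    by (simp add: ac_simps)
  then have "(\<integral>\<^sup>+ z. ennreal (h (fst z) (snd z)) \<partial>?P) = 0"
    using \<alpha>\<beta> by (subst (asm) ennreal_add_left_cancel) auto
  then have "AE z in ?P. ennreal (h (fst z) (snd z)) = 0"
    by (subst (asm) nn_integral_0_iff_AE) auto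
  then have "AE z in ?P. f' (fst z) * g' (snd z) = f (fst z) * g (snd z)"
    using AE_space
  proof eventually_elim
    case (elim z)
    obtain x y where z: "z = (x, y)" "x \<in> space M" "y \<in> space N"
      using elim(2) by (auto simp: space_pair_measure)
    have "p x y > 0" "f x + f' x > 0" "g y + g' y > 0"
      using kernel_pos z pos by (auto intro: add_pos_pos)
    then show ?case
      using elim(1) z by (auto simp: h_def ennreal_eq_0_iff divide_le_0_iff mult_le_0_iff)
  qed
  \<comment> \<open>Freezing one good point \<open>x0\<close> makes \<open>g'\<close> proportional
    to \<open>g\<close>, with \<open>k = f x0 / f' x0\<close>.\<close>
  from AE_pair[OF this] have fg: "AE x in M. AE y in N. f' x * g' y = f x * g y" by simp
  then obtain x0 where x0: "AE y in N. f' x0 * g' y = f x0 * g y"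
    using eventually_happens'[OF M.ae_filter_bot] by blast
  define k where "k = f x0 / f' x0"
  have k: "k > 0" using pos by (simp add: k_def)
  have g: "AE y in N. g' y = k * g y"
    using x0 by eventually_elim (use pos(2)[of x0] in \<open>simp add: k_def field_simps\<close>)
  have "AE x in M. f' x = inverse k * f x"
    using fg
  proof eventually_elim
    case (elim x)
    \<comment> \<open>After cancelling \<open>g y > 0\<close> the equation no longer involves
      \<open>y\<close>, so holding almost everywhere on a probability space means that it
      holds.\<close>
    from elim g have "AE y in N. f' x * k = f x"
      by eventually_elim (use pos(3) in \<open>auto simp: less_imp_neq[symmetric] mult.assoc[symmetric]\<close>)
    then have "f' x * k = f x" by simp
    then show ?case using k by (simp add: field_simps)
  qed
  with k show ?thesis using g by (rule that)
qed

section \<open>Uniqueness of solutions up to scaling\<close>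

lemma solution_densities:
  assumes sol: "schroedinger_solution M N p a b"
  obtains f g where "f \<in> borel_measurable M" "g \<in> borel_measurable N"
    "\<And>x. f x > 0" "\<And>y. g y > 0"
    "a = density M (\<lambda>x. ennreal (f x))" "b = density N (\<lambda>y. ennreal (g y))"
    "AE x in M. (\<integral>\<^sup>+ y. ennreal (p x y * (f x * g y)) \<partial>N) = 1"
    "AE y in N. (\<integral>\<^sup>+ x. ennreal (p x y * (f x * g y)) \<partial>M) = 1"
proof -
  interpret swapped: schroedinger_kernel N M "\<lambda>y x. p x y" by (rule swapped)
  obtain f where f [measurable]: "f \<in> borel_measurable M" and f_pos: "\<And>x. f x > 0"
    and a: "a = density M (\<lambda>x. ennreal (f x))"
    and f_eq: "AE x in M. ennreal (f x) * (\<integral>\<^sup>+ y. ennreal (p x y) \<partial>b) = 1"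
    using solution_density[OF sol] by blast
  obtain g where g [measurable]: "g \<in> borel_measurable N" and g_pos: "\<And>y. g y > 0"
    and b: "b = density N (\<lambda>y. ennreal (g y))"
    and g_eq: "AE y in N. ennreal (g y) * (\<integral>\<^sup>+ x. ennreal (p x y) \<partial>a) = 1"
    using swapped.solution_density[OF sol[unfolded schroedinger_solution_swap[of M]]] by blast
  \<comment> \<open>The two equations of the system become the statement that
    \<open>p x y * f x * g y\<close> is the density of a coupling of \<open>M\<close> and
    \<open>N\<close>.\<close>
  have "AE x in M. (\<integral>\<^sup>+ y. ennreal (p x y * (f x * g y)) \<partial>N) = 1"
    using f_eq AE_space
  proof eventually_elim
    case (elim x)
    have "(\<integral>\<^sup>+ y. ennreal (p x y * (f x * g y)) \<partial>N) = (\<integral>\<^sup>+ y. ennreal (f x) * (ennreal (g y) * ennreal (p x y)) \<partial>N)"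
      using kernel_pos[OF elim(2)] f_pos[of x] g_pos
      by (intro nn_integral_cong) (simp add: ennreal_mult'[symmetric] less_imp_le ac_simps)
    also have "\<dots> = ennreal (f x) * (\<integral>\<^sup>+ y. ennreal (p x y) \<partial>b)"
      using elim(2) unfolding b by (subst nn_integral_density) (auto intro!: nn_integral_cmult)
    finally show ?case using elim(1) by simp
  qed
  moreover have "AE y in N. (\<integral>\<^sup>+ x. ennreal (p x y * (f x * g y)) \<partial>M) = 1"
    using g_eq AE_space
  proof eventually_elim
    case (elim y)
    have "(\<integral>\<^sup>+ x. ennreal (p x y * (f x * g y)) \<partial>M) = (\<integral>\<^sup>+ x. ennreal (g y) * (ennreal (f x) * ennreal (p x y)) \<partial>M)"
      using kernel_pos[OF _ elim(2)] f_pos g_pos[of y]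
      by (intro nn_integral_cong) (simp add: ennreal_mult'[symmetric] less_imp_le ac_simps)
    also have "\<dots> = ennreal (g y) * (\<integral>\<^sup>+ x. ennreal (p x y) \<partial>a)"
      using elim(2) unfolding a by (subst nn_integral_density) (auto intro!: nn_integral_cmult)
    finally show ?case using elim(1) by simp
  qed
  ultimately show ?thesis using f g f_pos g_pos a b by (intro that)
qed

lemma solution_unique:
  assumes "schroedinger_solution M N p a b" and "schroedinger_solution M N p a' b'"
  shows "\<exists>k::real. k > 0 \<and> a' = scale_measure (ennreal (inverse k)) a \<and>
    b' = scale_measure (ennreal k) b"
proof -
  obtain f g where [measurable]: "f \<in> borel_measurable M" "g \<in> borel_measurable N"
    and pos: "\<And>x. f x > 0" "\<And>y. g y > 0"
    and ab: "a = density M (\<lambda>x. ennreal (f x))" "b = density N (\<lambda>y. ennreal (g y))"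
    and marg: "AE x in M. (\<integral>\<^sup>+ y. ennreal (p x y * (f x * g y)) \<partial>N) = 1"
      "AE y in N. (\<integral>\<^sup>+ x. ennreal (p x y * (f x * g y)) \<partial>M) = 1"
    using solution_densities[OF assms(1)] by blast
  obtain f' g' where [measurable]: "f' \<in> borel_measurable M" "g' \<in> borel_measurable N"
    and pos': "\<And>x. f' x > 0" "\<And>y. g' y > 0"
    and ab': "a' = density M (\<lambda>x. ennreal (f' x))" "b' = density N (\<lambda>y. ennreal (g' y))"
    and marg': "AE x in M. (\<integral>\<^sup>+ y. ennreal (p x y * (f' x * g' y)) \<partial>N) = 1"
      "AE y in N. (\<integral>\<^sup>+ x. ennreal (p x y * (f' x * g' y)) \<partial>M) = 1"
    using solution_densities[OF assms(2)] by blast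
  obtain k where k: "k > 0" and fg: "AE x in M. f' x = inverse k * f x" "AE y in N. g' y = k * g y"
    by (rule product_couplings_eq[of f f' g g']) (use pos pos' marg marg' in auto)
  have "a' = density M (\<lambda>x. ennreal (inverse k) * ennreal (f x))"
    unfolding ab' using fg(1)
    by (intro density_cong, measurable, eventually_elim) (use k in \<open>simp add: ennreal_mult'\<close>)
  moreover have "b' = density N (\<lambda>y. ennreal k * ennreal (g y))"
    unfolding ab' using fg(2)
    by (intro density_cong, measurable, eventually_elim) (use k in \<open>simp add: ennreal_mult'\<close>)
  ultimately show ?thesis
    using k by (auto simp: ab density_mult_const)
qed

end

section \<open>Both integrability alternatives, related by symmetry\<close>

theorem theorem1p1:
  fixes \<mu> :: "'a measure" and \<nu> :: "'b measure" and p :: "'a \<Rightarrow> 'b \<Rightarrow> real"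
  assumes "prob_space \<mu>" and "prob_space \<nu>"
    and "(\<lambda>(x, y). p x y) \<in> borel_measurable (\<mu> \<Otimes>\<^sub>M \<nu>)"
    and "\<And>x y. x \<in> space \<mu> \<Longrightarrow> y \<in> space \<nu> \<Longrightarrow> p x y > 0"
    and "(SUP x\<in>space \<mu>. SUP y\<in>space \<nu>. ennreal (p x y)) < \<infinity>"
    and "(\<integral>\<^sup>+ y. inverse (\<integral>\<^sup>+ x. ennreal (p x y) \<partial>\<mu>) \<partial>\<nu>) < \<infinity> \<or>
         (\<integral>\<^sup>+ x. inverse (\<integral>\<^sup>+ y. ennreal (p x y) \<partial>\<nu>) \<partial>\<mu>) < \<infinity>"
  shows "(\<exists>a b. schroedinger_solution \<mu> \<nu> p a b) \<and>
         (\<forall>a b a' b'. schroedinger_solution \<mu> \<nu> p a b \<longrightarrow> schroedinger_solution \<mu> \<nu> p a' b' \<longrightarrow>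
            (\<exists>\<kappa>::real. \<kappa> > 0 \<and> a' = scale_measure (ennreal (inverse \<kappa>)) a \<and>
               b' = scale_measure (ennreal \<kappa>) b))"
proof -
  interpret schroedinger_kernel \<mu> \<nu> p
    using assms by (simp add: schroedinger_kernel_def schroedinger_kernel_axioms_def)
  interpret swapped: schroedinger_kernel \<nu> \<mu> "\<lambda>y x. p x y" by (rule swapped)
  obtain C :: real where C: "(SUP x\<in>space \<mu>. SUP y\<in>space \<nu>. ennreal (p x y)) = ennreal C" and "C \<ge> 0"
    using assms(5) by (auto simp: less_top_ennreal)
  have p_le: "p x y \<le> C" if "x \<in> space \<mu>" "y \<in> space \<nu>" for x y
  proof -
    have "ennreal (p x y) \<le> ennreal C"
      unfolding C[symmetric] using that by (intro SUP_upper2[of x] SUP_upper) auto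
    then show ?thesis using \<open>C \<ge> 0\<close> by (simp add: ennreal_le_iff)
  qed
  have "\<exists>a b. schroedinger_solution \<mu> \<nu> p a b"
    using assms(6)
  proof
    assume "(\<integral>\<^sup>+ y. inverse (\<integral>\<^sup>+ x. ennreal (p x y) \<partial>\<mu>) \<partial>\<nu>) < \<infinity>"
    then show ?thesis using p_le by (rule exists_solution[rotated])
  next
    assume "(\<integral>\<^sup>+ x. inverse (\<integral>\<^sup>+ y. ennreal (p x y) \<partial>\<nu>) \<partial>\<mu>) < \<infinity>"
    \<comment> \<open>The second alternative is the first one for the transposed kernel, and the
      system itself is symmetric.\<close>
    then have "\<exists>b a. schroedinger_solution \<nu> \<mu> (\<lambda>y x. p x y) b a"
      using p_le by (rule swapped.exists_solution[rotated])
    then show ?thesis using schroedinger_solution_swap[of \<mu>] by blast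
  qed
  then show ?thesis using solution_unique by blast
qed

end
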